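(* Let $n\ge 1$ be an integer, and let $p,r\in(0,1)$ and $\lambda>0$ satisfy $\frac1p+\frac1r-\frac{\lambda}{n}=2$. Then there exists a constant $C(n,p,r)>0$ such that for all non-negative functions $f\in L^p(\mathbf{R}^n)$ and $g\in L^r(\mathbf{R}^n)$, $$\int_{\mathbf{R}^n}\int_{\mathbf{R}^n} f(x)\,|x-y|^{\lambda}\,g(y)\,dx\,dy\ \ge\ C(n,p,r)\,\|f\|_{L^p(\mathbf{R}^n)}\,\|g\|_{L^r(\mathbf{R}^n)}.$$
   Context: For an exponent $s\in(0,1)$, $\|f\|_{L^s(\mathbf{R}^n)}=\left(\int_{\mathbf{R}^n}|f|^s\,dx\right)^{1/s}$ and $L^s(\mathbf{R}^n)$ is the set of measurable functions for which this is finite. The double integral on the left is an integral of a non-negative function and may equal $+\infty$. *)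

theory Defs
  imports "HOL-Analysis.Analysis"
begin

text \<open>
  The spaces and quasi-norms are over Lebesgue measure, for exponents \<open>s > 0\<close>, so that
  \<open>0 powr s = 0\<close> agrees with the usual \<open>0\<^sup>s = 0\<close>. Functions are not identified almost everywhere.
\<close>

definition Lspace :: "real \<Rightarrow> ('a::euclidean_space \<Rightarrow> real) set" where
  "Lspace s = {f \<in> borel_measurable lebesgue. (\<integral>\<^sup>+ x. ennreal (\<bar>f x\<bar> powr s) \<partial>lebesgue) < \<infinity>}"

text \<open>
  Outside \<open>Lspace s\<close> the integral may be infinite, and then the following real number is \<open>0\<close>;
  it is meaningful only on \<open>Lspace s\<close>.
\<close>

definition Lnorm :: "real \<Rightarrow> ('a::euclidean_space \<Rightarrow> real) \<Rightarrow> real" where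
  "Lnorm s f = enn2real (\<integral>\<^sup>+ x. ennreal (\<bar>f x\<bar> powr s) \<partial>lebesgue) powr (1 / s)"

end

theory Submission
  imports Defs
begin

text \<open>
  Write \<open>n\<close> for the dimension, \<open>F y = \<integral> f x * |x - y|^lam dx\<close> and \<open>d = n * (1/p - 1)\<close>, so that the
  relation between the exponents reads \<open>lam = d + n * (1/r - 1)\<close>. Everything rests on one lower bound
  for integrals against a radial weight (\<open>weighted_integral_ge\<close>): if \<open>lam > d\<close>, then
  \<open>\<integral> f x * (\<rho> + |x - a|)^lam dx \<ge> c * \<rho>^(lam - d) * \<parallel>f\<parallel>\<^sub>p\<close>. It is a reverse Hoelder inequality: the
  weight may be small only near \<open>a\<close>, and \<open>lam > d\<close> says exactly that the dual power
  \<open>(\<rho> + |x - a|)^(- lam / (1/p - 1))\<close> of the weight is integrable.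

  The kernel \<open>|x - y|^lam\<close> is not bounded below by such a weight near \<open>x = y\<close>, so the length \<open>\<rho>\<close> has
  to be found in \<open>f\<close>. Let \<open>R\<close> be, up to a factor 2, the smallest radius of a ball \<open>B(x0, R)\<close> carrying
  half of the mass \<open>\<integral> f^p\<close> (\<open>exists_critical_ball\<close>); no ball of radius \<open>R/2\<close> carries as much, wherever
  its centre is. If \<open>y\<close> is within \<open>2R\<close> of \<open>x0\<close>, then half of the mass lies outside \<open>B(y, R/2)\<close>, where
  \<open>|x - y|\<close> is comparable to \<open>R + |x - y|\<close>; if \<open>y\<close> is farther away, then \<open>|x - y|\<close> is comparable to
  \<open>|y - x0|\<close> on \<open>B(x0, R)\<close>. Both cases give
  \<open>F y \<ge> c * \<parallel>f\<parallel>\<^sub>p * R^(-d) * (R + |y - x0|)^lam\<close> for every \<open>y\<close> (\<open>potential_ge\<close>).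

  This lower bound for \<open>F\<close> is itself a radial weight. Integrating it against \<open>g\<close> and applying
  \<open>weighted_integral_ge\<close> again, now with the exponent \<open>r\<close>, gives the factor
  \<open>R^(lam - n * (1/r - 1)) * \<parallel>g\<parallel>\<^sub>r = R^d * \<parallel>g\<parallel>\<^sub>r\<close>, and the powers of \<open>R\<close> cancel.
\<close>

section \<open>Integrals against radial weights\<close>

text \<open>
  The balls of radius \<open>2^k * \<rho>\<close> about \<open>a\<close> cut the space into dyadic shells; the \<open>k\<close>-th shell
  contributes about \<open>(2^k * \<rho>)^(n - q)\<close>, which is a convergent geometric series for \<open>q > n\<close>.
  Carrying \<open>\<rho>\<close> and \<open>a\<close> along makes a change of variables unnecessary.
\<close>

lemma nn_integral_shifted_power_le:
  fixes q :: real
  assumes q: "real DIM('a::euclidean_space) < q"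
  obtains K where "K > 0" and "\<And>\<rho> (a::'a). 0 < \<rho> \<Longrightarrow>
    (\<integral>\<^sup>+x. ennreal ((\<rho> + norm (x - a)) powr - q) \<partial>lebesgue)
      \<le> ennreal (K * \<rho> powr (real DIM('a) - q))"
proof -
  let ?n = "real DIM('a)"
  define V where "V = unit_ball_vol ?n"
  have V: "V > 0" unfolding V_def by simp
  define z where "z = 2 powr (?n - q)"
  have z: "0 < z" "z < 1" unfolding z_def using q by (auto simp: powr_less_one)
  define K where "K = 2 powr q * V * (1 / (1 - z))"
  have K: "K > 0" unfolding K_def using V z by simp
  show ?thesis
  proof (rule that[OF K])
    fix \<rho> :: real and a :: 'a assume \<rho>: "\<rho> > 0"
    let ?r = "\<lambda>k::nat. 2 ^ k * \<rho>"
    define s where "s k x = ennreal ((?r k / 2) powr - q) * indicator (cball a (?r k)) x" for k x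
    have meas: "s k \<in> borel_measurable lebesgue" for k
      unfolding s_def by (intro borel_measurable_times_ennreal borel_measurable_const borel_measurable_indicator) simp
    \<comment> \<open>The least ball containing \<open>x\<close> suffices: \<open>x\<close> lies outside the ball of half its radius,
        unless \<open>k = 0\<close>, where \<open>\<rho>\<close> alone is large enough.\<close>
    have shell: "ennreal ((\<rho> + norm (x - a)) powr - q) \<le> (\<Sum>k. s k x)" for x
    proof -
      obtain N :: nat where "norm (x - a) / \<rho> < 2 ^ N"
        using real_arch_pow[of 2 "norm (x - a) / \<rho>"] by auto
      then have ex: "norm (x - a) \<le> ?r N" using \<rho> by (simp add: divide_simps)
      define k where "k = (LEAST k. norm (x - a) \<le> ?r k)"
      have k: "norm (x - a) \<le> ?r k"
        unfolding k_def by (rule LeastI[of "\<lambda>k. norm (x - a) \<le> ?r k", OF ex])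
      have low: "?r k / 2 \<le> \<rho> + norm (x - a)"
      proof (cases k)
        case 0 then show ?thesis using \<rho> by (simp add: add_nonneg_nonneg add.commute add_increasing)
      next
        case (Suc j)
        have "\<not> norm (x - a) \<le> ?r j"
          using not_less_Least[of j "\<lambda>k. norm (x - a) \<le> ?r k"] Suc k_def by simp
        then show ?thesis using Suc \<rho> by simp
      qed
      have "(\<rho> + norm (x - a)) powr - q \<le> (?r k / 2) powr - q"
        using low \<rho> q by (intro powr_mono2') auto
      then have "ennreal ((\<rho> + norm (x - a)) powr - q) \<le> s k x"
        using k unfolding s_def by (simp add: dist_norm norm_minus_commute ennreal_leI)
      also have "\<dots> = (\<Sum>i\<in>{k}. s i x)" by simp
      also have "\<dots> \<le> (\<Sum>k. s k x)" by (rule sum_le_suminf) auto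
      finally show ?thesis .
    qed
    have int: "(\<integral>\<^sup>+x. s k x \<partial>lebesgue) = ennreal (2 powr q * V * \<rho> powr (?n - q) * z ^ k)" for k
    proof -
      have pos: "?r k > 0" using \<rho> by simp
      have "(\<integral>\<^sup>+x. s k x \<partial>lebesgue) = ennreal ((?r k / 2) powr - q) * emeasure lborel (cball a (?r k))"
        unfolding s_def by (subst nn_integral_cmult_indicator) auto
      also have "\<dots> = ennreal ((?r k / 2) powr - q * (V * ?r k powr ?n))"
        using pos unfolding V_def by (subst emeasure_cball) (auto simp: ennreal_mult' powr_realpow)
      also have "(?r k / 2) powr - q * (V * ?r k powr ?n) = 2 powr q * V * (?r k powr (?n - q))"
        using pos by (simp add: powr_divide powr_minus powr_diff field_simps)
      also have "?r k powr (?n - q) = \<rho> powr (?n - q) * z ^ k"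
        using \<rho> unfolding z_def
        by (simp add: powr_mult powr_powr flip: powr_realpow) (simp add: mult.commute)
      finally show ?thesis by (simp add: mult_ac)
    qed
    have "(\<integral>\<^sup>+x. ennreal ((\<rho> + norm (x - a)) powr - q) \<partial>lebesgue) \<le> (\<integral>\<^sup>+x. (\<Sum>k. s k x) \<partial>lebesgue)"
      by (intro nn_integral_mono shell)
    also have "\<dots> = (\<Sum>k. ennreal (2 powr q * V * \<rho> powr (?n - q) * z ^ k))"
      by (simp add: nn_integral_suminf meas int)
    also have "\<dots> = ennreal (2 powr q * V * \<rho> powr (?n - q) * (1 / (1 - z)))"
      using z V by (intro suminf_ennreal_eq sums_mult geometric_sums) auto
    finally show "(\<integral>\<^sup>+x. ennreal ((\<rho> + norm (x - a)) powr - q) \<partial>lebesgue)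
      \<le> ennreal (K * \<rho> powr (?n - q))"
      unfolding K_def by (simp add: mult_ac)
  qed
qed

text \<open>
  A reverse Hoelder inequality, in which the dual norm of the weight \<open>w = (\<rho> + |x - a|)^lam\<close> is
  bounded by the preceding lemma. Interpolation is replaced by the pointwise alternative
  \<open>f^p \<le> T * f * w\<close> or \<open>f^p \<le> (T * w)^(- p / (1 - p))\<close>, valid for each \<open>T > 0\<close>. Integrating over \<open>A\<close> and
  choosing \<open>T\<close> such that the second part amounts to at most half of \<open>m\<close> leaves
  \<open>m / 2 \<le> T * \<integral> f * w\<close>. Only a lower bound \<open>m\<close> for the mass enters, so the lemma applies to portions of
  the mass of a function.
\<close>

lemma weighted_integral_ge:
  fixes p lam :: real
  assumes p: "0 < p" "p < 1" and lam: "real DIM('a::euclidean_space) * (1 / p - 1) < lam"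
  obtains c where "c > 0" and "\<And>(f::'a \<Rightarrow> real) A \<rho> a m.
    \<lbrakk>f \<in> borel_measurable lebesgue; \<forall>x. 0 \<le> f x; A \<in> sets lebesgue; 0 < \<rho>; 0 < m;
     ennreal m \<le> (\<integral>\<^sup>+x\<in>A. ennreal (f x powr p) \<partial>lebesgue)\<rbrakk> \<Longrightarrow>
    ennreal (c * \<rho> powr (lam - real DIM('a) * (1 / p - 1)) * m powr (1 / p))
      \<le> (\<integral>\<^sup>+x\<in>A. ennreal (f x * (\<rho> + norm (x - a)) powr lam) \<partial>lebesgue)"
proof -
  let ?n = "real DIM('a)"
  define \<alpha> where "\<alpha> = 1 / p - 1"
  have \<alpha>: "\<alpha> > 0" using p unfolding \<alpha>_def by simp
  have p\<alpha>: "p * (1 + \<alpha>) = 1" using p unfolding \<alpha>_def by simp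
  define q where "q = lam / \<alpha>"
  have q: "?n < q" using lam \<alpha> unfolding q_def \<alpha>_def by (simp add: pos_less_divide_eq)
  have q\<alpha>: "q * \<alpha> = lam" using \<alpha> unfolding q_def by simp
  obtain K where K: "K > 0" and Kb: "\<And>\<rho> a::'a. \<rho> > 0 \<Longrightarrow>
      (\<integral>\<^sup>+x. ennreal ((\<rho> + norm (x - a)) powr - q) \<partial>lebesgue) \<le> ennreal (K * \<rho> powr (?n - q))"
    by (rule nn_integral_shifted_power_le[OF q]) blast
  define c where "c = (2 * K) powr - \<alpha> / 2"
  have c: "c > 0" unfolding c_def using K by simp
  show ?thesis
  proof (rule that[OF c])
    fix f :: "'a \<Rightarrow> real" and A and \<rho> m :: real and a :: 'a
    assume f[measurable]: "f \<in> borel_measurable lebesgue" and f0: "\<forall>x. 0 \<le> f x"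
      and A[measurable]: "A \<in> sets lebesgue" and \<rho>: "0 < \<rho>" and m: "0 < m"
      and mle: "ennreal m \<le> (\<integral>\<^sup>+x\<in>A. ennreal (f x powr p) \<partial>lebesgue)"
    define w where "w x = \<rho> + norm (x - a)" for x
    have w: "w x > 0" for x unfolding w_def using \<rho> by (simp add: add_pos_nonneg)
    have [measurable]: "w \<in> borel_measurable lebesgue"
      unfolding w_def by (intro measurable_completion) measurable
    define I where "I = (\<integral>\<^sup>+x\<in>A. ennreal (f x * w x powr lam) \<partial>lebesgue)"
    \<comment> \<open>The solution of \<open>T^(-1/\<alpha>) * K * \<rho>^(n - q) = m / 2\<close>; note that \<open>1/\<alpha> = p / (1 - p)\<close>.\<close>
    define T where "T = (2 * K * \<rho> powr (?n - q) / m) powr \<alpha>"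
    have T: "T > 0" unfolding T_def using K \<rho> m by simp
    have split: "f x powr p \<le> T * (f x * w x powr lam) + T powr (- 1 / \<alpha>) * w x powr - q" for x
    proof (cases "f x powr p \<le> T * (f x * w x powr lam)")
      case True
      then show ?thesis by (simp add: add_increasing2)
    next
      case False
      then have fx: "f x > 0" using f0[rule_format, of x] by (cases "f x = 0") auto
      have "T * w x powr lam < f x powr (p - 1)"
        using False fx by (simp add: powr_diff field_simps)
      then have "(f x powr (p - 1)) powr (- 1 / \<alpha>) \<le> (T * w x powr lam) powr (- 1 / \<alpha>)"
        using T w[of x] \<alpha> by (intro powr_mono2') auto
      moreover have "(p - 1) * (- 1 / \<alpha>) = p"
        using \<alpha> p\<alpha> by (simp add: field_simps)
      moreover have "lam * (- 1 / \<alpha>) = - q" unfolding q_def by simp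
      ultimately have "f x powr p \<le> T powr (- 1 / \<alpha>) * w x powr - q"
        using T w[of x] by (simp add: powr_powr powr_mult)
      moreover have "0 \<le> T * (f x * w x powr lam)" using T fx by simp
      ultimately show ?thesis by linarith
    qed
    have tail: "ennreal (T powr (- 1 / \<alpha>)) * (\<integral>\<^sup>+x. ennreal (w x powr - q) \<partial>lebesgue) \<le> ennreal (m / 2)"
    proof -
      have "T powr (- 1 / \<alpha>) = (2 * K * \<rho> powr (?n - q) / m) powr - 1"
        unfolding T_def powr_powr using \<alpha> by simp
      also have "\<dots> = m / (2 * (K * \<rho> powr (?n - q)))"
        using K \<rho> m by (simp add: powr_minus)
      finally have "T powr (- 1 / \<alpha>) * (K * \<rho> powr (?n - q)) = m / 2"
        using K \<rho> by simp
      moreover have "ennreal (T powr (- 1 / \<alpha>)) * (\<integral>\<^sup>+x. ennreal (w x powr - q) \<partial>lebesgue)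
          \<le> ennreal (T powr (- 1 / \<alpha>)) * ennreal (K * \<rho> powr (?n - q))"
        unfolding w_def by (intro mult_left_mono Kb \<rho>) auto
      ultimately show ?thesis by (metis ennreal_mult' powr_ge_zero)
    qed
    have "ennreal m \<le> (\<integral>\<^sup>+x. ennreal T * (ennreal (f x * w x powr lam) * indicator A x)
        + ennreal (T powr (- 1 / \<alpha>)) * ennreal (w x powr - q) \<partial>lebesgue)"
    proof (rule order_trans[OF mle], rule nn_integral_mono)
      fix x
      have "ennreal (f x powr p) \<le> ennreal T * ennreal (f x * w x powr lam)
          + ennreal (T powr (- 1 / \<alpha>)) * ennreal (w x powr - q)"
        using split[of x] T f0
        by (simp flip: ennreal_mult ennreal_plus add: ennreal_leI)
      then show "ennreal (f x powr p) * indicator A x \<le> ennreal T * (ennreal (f x * w x powr lam) * indicator A x)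
        + ennreal (T powr (- 1 / \<alpha>)) * ennreal (w x powr - q)"
        by (auto simp: indicator_def)
    qed
    also have "\<dots> = ennreal T * I + ennreal (T powr (- 1 / \<alpha>)) * (\<integral>\<^sup>+x. ennreal (w x powr - q) \<partial>lebesgue)"
      unfolding I_def by (simp add: nn_integral_add nn_integral_cmult)
    also have "\<dots> \<le> ennreal T * I + ennreal (m / 2)"
      using tail by (rule add_left_mono)
    finally have main: "ennreal m \<le> ennreal T * I + ennreal (m / 2)" .
    have "ennreal (m / (2 * T)) \<le> I"
    proof (cases I)
      case (real i)
      then have "m \<le> T * i + m / 2"
        using main T m by (simp flip: ennreal_mult ennreal_plus)
      then show ?thesis using real T by (simp add: field_simps ennreal_leI)
    qed simp
    also have "m / (2 * T) = c * \<rho> powr (lam - ?n * \<alpha>) * m powr (1 / p)"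
    proof -
      have e: "1 / p = 1 + \<alpha>" unfolding \<alpha>_def by simp
      have "1 / T = (2 * K) powr - \<alpha> * \<rho> powr (lam - ?n * \<alpha>) * m powr \<alpha>"
        using K \<rho> m q\<alpha> unfolding T_def
        by (simp add: powr_mult powr_divide powr_powr left_diff_distrib powr_minus powr_diff field_simps)
      then have "m / (2 * T) = m * ((2 * K) powr - \<alpha> * \<rho> powr (lam - ?n * \<alpha>) * m powr \<alpha>) / 2"
        using T by (simp add: field_simps)
      then show ?thesis unfolding c_def e using m by (simp add: powr_add)
    qed
    finally show "ennreal (c * \<rho> powr (lam - ?n * (1 / p - 1)) * m powr (1 / p))
      \<le> (\<integral>\<^sup>+x\<in>A. ennreal (f x * (\<rho> + norm (x - a)) powr lam) \<partial>lebesgue)"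
      unfolding I_def w_def \<alpha>_def .
  qed
qed

section \<open>Concentration of mass\<close>

text \<open>
  Uniform absolute continuity of \<open>h dx\<close>. The part of the mass on which \<open>h\<close> exceeds a high level \<open>k\<close> is
  small, because these sets decrease to the empty set; on the rest \<open>h dx\<close> is at most \<open>k\<close> times Lebesgue
  measure, which is small on small balls irrespective of their centres.
\<close>

lemma small_balls_small_mass:
  fixes h :: "'a::euclidean_space \<Rightarrow> real"
  assumes h[measurable]: "h \<in> borel_measurable lebesgue"
    and fin: "(\<integral>\<^sup>+x. ennreal (h x) \<partial>lebesgue) < \<infinity>" and e: "0 < e"
  shows "\<exists>\<delta>>0. \<forall>s y. s \<le> \<delta> \<longrightarrow> emeasure (density lebesgue h) (cball y s) < ennreal e"
proof -
  let ?\<nu> = "density lebesgue (\<lambda>x. ennreal (h x))"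
  let ?n = "real DIM('a)"
  define A where "A k = {x. real k < h x}" for k :: nat
  have A[measurable]: "A k \<in> sets lebesgue" for k
    using measurable_sets[OF h, of "{real k<..}"] by (simp add: A_def vimage_def)
  have finA: "emeasure ?\<nu> B \<noteq> \<infinity>" for B
  proof -
    have "emeasure ?\<nu> B \<le> emeasure ?\<nu> (space ?\<nu>)" by (rule emeasure_space)
    also have "\<dots> < \<infinity>" using fin by (subst emeasure_density) auto
    finally show ?thesis by simp
  qed
  have "decseq A" unfolding decseq_def A_def by (force intro: le_less_trans)
  moreover have "(\<Inter>k. A k) = {}"
  proof -
    have "\<exists>k. x \<notin> A k" for x
      using real_arch_simple[of "h x"] by (auto simp: A_def not_less)
    then show ?thesis by blast
  qed
  moreover have "range A \<subseteq> sets ?\<nu>" by auto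
  ultimately have "(\<lambda>k. emeasure ?\<nu> (A k)) \<longlonglongrightarrow> 0"
    using Lim_emeasure_decseq[of A ?\<nu>] finA by auto
  then have "\<forall>\<^sub>F k in sequentially. emeasure ?\<nu> (A k) < ennreal (e / 2)"
    using e by (intro order_tendstoD) auto
  then obtain k where k: "emeasure ?\<nu> (A k) < ennreal (e / 2)"
    by (auto simp: eventually_sequentially)
  define V where "V = unit_ball_vol ?n"
  have V: "V > 0" unfolding V_def by simp
  define \<kappa> where "\<kappa> = real k + 1"
  have \<kappa>: "\<kappa> > 0" unfolding \<kappa>_def by simp
  define b where "b = e / (2 * \<kappa> * V)"
  have b: "b > 0" unfolding b_def using e V \<kappa> by simp
  define \<delta> where "\<delta> = b powr (1 / ?n)"
  have \<delta>: "\<delta> > 0" unfolding \<delta>_def using b by simp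
  have \<delta>n: "\<delta> ^ DIM('a) = b"
    using \<delta> b by (simp add: \<delta>_def powr_powr flip: powr_realpow)
  show ?thesis
  proof (intro exI[of _ \<delta>] conjI \<delta> allI impI)
    fix s :: real and y :: 'a assume "s \<le> \<delta>"
    then have "emeasure ?\<nu> (cball y s) \<le> emeasure ?\<nu> (cball y \<delta>)"
      by (intro emeasure_mono) (auto simp: subset_cball)
    also have "\<dots> \<le> emeasure ?\<nu> (A k \<union> (cball y \<delta> - A k))"
      by (intro emeasure_mono) auto
    also have "\<dots> \<le> emeasure ?\<nu> (A k) + emeasure ?\<nu> (cball y \<delta> - A k)"
      by (rule emeasure_subadditive) auto
    also have "emeasure ?\<nu> (cball y \<delta> - A k) \<le> ennreal (e / 2)"
    proof -
      have "emeasure ?\<nu> (cball y \<delta> - A k)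
          = (\<integral>\<^sup>+x. ennreal (h x) * indicator (cball y \<delta> - A k) x \<partial>lebesgue)"
        by (subst emeasure_density) auto
      also have "\<dots> \<le> (\<integral>\<^sup>+x. ennreal (real k) * indicator (cball y \<delta>) x \<partial>lebesgue)"
        by (intro nn_integral_mono) (auto simp: A_def indicator_def not_less ennreal_leI)
      also have "\<dots> = ennreal (real k) * emeasure lborel (cball y \<delta>)"
        by (subst nn_integral_cmult_indicator) auto
      also have "\<dots> = ennreal (real k * (V * b))"
        using \<delta> \<delta>n by (simp add: emeasure_cball V_def ennreal_mult')
      also have "real k * (V * b) \<le> \<kappa> * (V * b)"
        using V b unfolding \<kappa>_def by (intro mult_right_mono) auto
      also have "\<dots> = e / 2"
        using V \<kappa> unfolding b_def by simp
      finally show ?thesis by (simp add: ennreal_leI)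
    qed
    finally have "emeasure ?\<nu> (cball y s) \<le> ennreal (e / 2) + emeasure ?\<nu> (A k)"
      by (simp add: add_left_mono add.commute)
    also have "\<dots> < ennreal (e / 2) + ennreal (e / 2)"
      unfolding ennreal_add_left_cancel_less using k by simp
    also have "\<dots> = ennreal e" using e by (simp flip: ennreal_plus)
    finally show "emeasure ?\<nu> (cball y s) < ennreal e" .
  qed
qed

text \<open>
  Start from a large ball with more than half of the mass and keep halving the radius. By uniform
  absolute continuity some radius \<open>R\<close> on the way still admits a ball with half of the mass while
  \<open>R / 2\<close> does not admit one at any centre.
\<close>

lemma exists_critical_ball:
  fixes h :: "'a::euclidean_space \<Rightarrow> real"
  assumes h[measurable]: "h \<in> borel_measurable lebesgue"
    and M: "(\<integral>\<^sup>+x. ennreal (h x) \<partial>lebesgue) = ennreal M" "0 < M"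
  shows "\<exists>x0 R. 0 < R \<and> ennreal (M / 2) \<le> emeasure (density lebesgue h) (cball x0 R) \<and>
    (\<forall>y. ennreal (M / 2) \<le> emeasure (density lebesgue h) (- cball y (R / 2)))"
proof -
  let ?\<nu> = "density lebesgue (\<lambda>x. ennreal (h x))"
  have tot: "emeasure ?\<nu> UNIV = ennreal M"
    using M by (subst emeasure_density) auto
  define P where "P s \<longleftrightarrow> (\<exists>x. ennreal (M / 2) \<le> emeasure ?\<nu> (cball x s))" for s
  obtain \<delta> where \<delta>: "\<delta> > 0"
    and small: "\<And>s y. s \<le> \<delta> \<Longrightarrow> emeasure ?\<nu> (cball y s) < ennreal (M / 2)"
    using small_balls_small_mass[OF h, of "M / 2"] M by auto
  then have notP: "\<not> P s" if "s \<le> \<delta>" for s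
    using that unfolding P_def by (auto simp: not_le)
  have "(\<lambda>N::nat. emeasure ?\<nu> (cball 0 (real N))) \<longlonglongrightarrow> emeasure ?\<nu> (\<Union>N. cball 0 (real N))"
    by (rule Lim_emeasure_incseq) (auto simp: incseq_def)
  also have "(\<Union>N. cball (0::'a) (real N)) = UNIV"
    using real_arch_simple by auto
  finally have "\<forall>\<^sub>F N in sequentially. ennreal (M / 2) < emeasure ?\<nu> (cball 0 (real N))"
    using M by (intro order_tendstoD) (auto simp: tot ennreal_lessI)
  then obtain N :: nat where "ennreal (M / 2) < emeasure ?\<nu> (cball 0 (real N))"
    by (auto simp: eventually_sequentially)
  then have PN: "P (real N / 2 ^ 0)" unfolding P_def by (auto intro: less_imp_le)
  obtain k0 :: nat where "real N / \<delta> < 2 ^ k0"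
    using real_arch_pow[of 2] by auto
  then have "real N / 2 ^ k0 \<le> \<delta>" using \<delta> by (simp add: field_simps)
  then have ex: "\<not> P (real N / 2 ^ k0)" by (rule notP)
  define k where "k = (LEAST k. \<not> P (real N / 2 ^ k))"
  have k: "\<not> P (real N / 2 ^ k)"
    unfolding k_def by (rule LeastI[of "\<lambda>k. \<not> P (real N / 2 ^ k)", OF ex])
  with PN have "k \<noteq> 0" by metis
  then obtain j where j: "k = Suc j" by (cases k) auto
  define R where "R = real N / 2 ^ j"
  have PR: "P R"
    unfolding R_def using not_less_Least[of j "\<lambda>k. \<not> P (real N / 2 ^ k)"] j k_def by simp
  then have R: "R > 0" using notP[of R] \<delta> by linarith
  have "real N / 2 ^ k = R / 2" unfolding R_def j by simp
  with k have half: "emeasure ?\<nu> (cball y (R / 2)) < ennreal (M / 2)" for y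
    unfolding P_def by (auto simp: not_le)
  have "ennreal (M / 2) \<le> emeasure ?\<nu> (- cball y (R / 2))" for y
  proof (rule ccontr)
    assume "\<not> ?thesis"
    then have *: "emeasure ?\<nu> (- cball y (R / 2)) < ennreal (M / 2)" by simp
    have "ennreal M = emeasure ?\<nu> (cball y (R / 2) \<union> - cball y (R / 2))"
      by (simp only: Compl_partition tot)
    also have "\<dots> \<le> emeasure ?\<nu> (cball y (R / 2)) + emeasure ?\<nu> (- cball y (R / 2))"
      by (rule emeasure_subadditive) auto
    also have "\<dots> < ennreal (M / 2) + ennreal (M / 2)"
      using half[of y] * by (rule add_strict_mono)
    also have "\<dots> = ennreal M" using M by (simp flip: ennreal_plus)
    finally show False by simp
  qed
  then show ?thesis using PR R unfolding P_def by blast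
qed

section \<open>The reversed Hardy-Littlewood-Sobolev inequality\<close>

text \<open>
  For each \<open>y\<close>, at least half of the mass of \<open>f^p\<close> lies on a set \<open>A\<close> where the kernel is comparable to a radial
  weight: \<open>|x - y| \<ge> \<theta> * (R + |x - a|)\<close> with \<open>\<theta> = (R + |y - x0|) / (9 * R)\<close>. For \<open>y\<close> near the critical ball,
  \<open>A\<close> is the complement of a small ball about \<open>y\<close> and \<open>a = y\<close>; for \<open>y\<close> far away, \<open>A\<close> is the critical ball
  and \<open>a = x0\<close>.
\<close>

lemma potential_ge:
  fixes p lam :: real
  assumes p: "0 < p" "p < 1" and lam: "real DIM('a::euclidean_space) * (1 / p - 1) < lam"
  obtains c where "c > 0" and "\<And>(f::'a \<Rightarrow> real) m.
    \<lbrakk>f \<in> borel_measurable lebesgue; \<forall>x. 0 \<le> f x; 0 < m;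
     (\<integral>\<^sup>+x. ennreal (f x powr p) \<partial>lebesgue) = ennreal m\<rbrakk> \<Longrightarrow>
    \<exists>x0 R. 0 < R \<and> (\<forall>y.
      ennreal (c * R powr - (real DIM('a) * (1 / p - 1)) * m powr (1 / p) * (R + norm (y - x0)) powr lam)
        \<le> (\<integral>\<^sup>+x. ennreal (f x * norm (x - y) powr lam) \<partial>lebesgue))"
proof -
  define d where "d = real DIM('a) * (1 / p - 1)"
  have d: "0 \<le> d" "d < lam" unfolding d_def using p lam by auto
  obtain c0 where c0: "c0 > 0" and W: "\<And>(f::'a \<Rightarrow> real) A \<rho> a m.
    f \<in> borel_measurable lebesgue \<Longrightarrow> (\<forall>x. 0 \<le> f x) \<Longrightarrow> A \<in> sets lebesgue \<Longrightarrow> 0 < \<rho> \<Longrightarrow> 0 < m \<Longrightarrow>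
    ennreal m \<le> (\<integral>\<^sup>+x\<in>A. ennreal (f x powr p) \<partial>lebesgue) \<Longrightarrow>
    ennreal (c0 * \<rho> powr (lam - d) * m powr (1 / p))
      \<le> (\<integral>\<^sup>+x\<in>A. ennreal (f x * (\<rho> + norm (x - a)) powr lam) \<partial>lebesgue)"
    by (rule weighted_integral_ge[OF p lam, folded d_def]) blast
  define c where "c = c0 * (1 / 9) powr lam * (1 / 2) powr (1 / p)"
  have c: "c > 0" unfolding c_def using c0 by simp
  show ?thesis
  proof (rule that[OF c])
    fix f :: "'a \<Rightarrow> real" and m :: real
    assume f[measurable]: "f \<in> borel_measurable lebesgue" and f0: "\<forall>x. 0 \<le> f x" and m: "0 < m"
      and fm: "(\<integral>\<^sup>+x. ennreal (f x powr p) \<partial>lebesgue) = ennreal m"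
    let ?\<nu> = "density lebesgue (\<lambda>x. ennreal (f x powr p))"
    have mass: "emeasure ?\<nu> A = (\<integral>\<^sup>+x\<in>A. ennreal (f x powr p) \<partial>lebesgue)" if "A \<in> sets lebesgue" for A
      using that by (subst emeasure_density) auto
    obtain x0 R where R: "R > 0" and inner: "ennreal (m / 2) \<le> emeasure ?\<nu> (cball x0 R)"
      and outer: "\<And>y. ennreal (m / 2) \<le> emeasure ?\<nu> (- cball y (R / 2))"
      using exists_critical_ball[OF _ fm m] by auto
    have "ennreal (c * R powr - d * m powr (1 / p) * (R + norm (y - x0)) powr lam)
        \<le> (\<integral>\<^sup>+x. ennreal (f x * norm (x - y) powr lam) \<partial>lebesgue)" for y
    proof -
      define t where "t = norm (y - x0)"
      have t: "t \<ge> 0" unfolding t_def by simp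
      \<comment> \<open>The denominator \<open>9 * R\<close> makes \<open>\<theta> \<le> 1/3\<close> when \<open>t \<le> 2 * R\<close>, as the near case needs;
        the far case would allow a larger \<open>\<theta>\<close>.\<close>
      define \<theta> where "\<theta> = (R + t) / (9 * R)"
      have \<theta>: "\<theta> > 0" unfolding \<theta>_def using R t by simp
      obtain A a where A[measurable]: "A \<in> sets lebesgue" and mA: "ennreal (m / 2) \<le> emeasure ?\<nu> A"
        and far: "\<And>x. x \<in> A \<Longrightarrow> \<theta> * (R + norm (x - a)) \<le> norm (x - y)"
      proof (cases "t \<le> 2 * R")
        case True
        have "\<theta> * (R + norm (x - y)) \<le> norm (x - y)" if "x \<in> - cball y (R / 2)" for x
        proof -
          have "\<theta> \<le> 1 / 3" unfolding \<theta>_def using True R by (simp add: field_simps)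
          then have "\<theta> * (R + norm (x - y)) \<le> 1 / 3 * (R + norm (x - y))"
            using R by (intro mult_right_mono) auto
          also have "\<dots> \<le> norm (x - y)"
            using that by (simp add: dist_norm norm_minus_commute)
          finally show ?thesis .
        qed
        then show ?thesis by (intro that[of "- cball y (R / 2)" y] outer) auto
      next
        case False
        have "\<theta> * (R + norm (x - x0)) \<le> norm (x - y)" if "x \<in> cball x0 R" for x
        proof -
          have x: "norm (x - x0) \<le> R" using that by (simp add: dist_norm norm_minus_commute)
          have "t \<le> norm (x - y) + norm (x - x0)"
            unfolding t_def using norm_triangle_ineq4[of "x - x0" "x - y"] by simp
          \<comment> \<open>\<open>t > 2 * R\<close> gives \<open>|x - y| \<ge> t - R \<ge> (R + t) / 3\<close>.\<close>
          then have "2 / 9 * (R + t) \<le> norm (x - y)" using x False R by simp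
          moreover have "\<theta> * (R + norm (x - x0)) \<le> \<theta> * (2 * R)"
            using x \<theta> by (intro mult_left_mono) auto
          moreover have "\<theta> * (2 * R) = 2 / 9 * (R + t)" unfolding \<theta>_def using R by simp
          ultimately show ?thesis by linarith
        qed
        then show ?thesis by (intro that[of "cball x0 R" x0] inner) auto
      qed
      have "c * R powr - d * m powr (1 / p) * (R + t) powr lam
          = \<theta> powr lam * (c0 * R powr (lam - d) * (m / 2) powr (1 / p))"
        unfolding c_def \<theta>_def using R t m
        by (simp add: powr_divide powr_mult powr_diff powr_minus field_simps)
      then have "ennreal (c * R powr - d * m powr (1 / p) * (R + t) powr lam)
          = ennreal (\<theta> powr lam) * ennreal (c0 * R powr (lam - d) * (m / 2) powr (1 / p))"
        by (simp add: ennreal_mult')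
      also have "\<dots> \<le> ennreal (\<theta> powr lam) * (\<integral>\<^sup>+x\<in>A. ennreal (f x * (R + norm (x - a)) powr lam) \<partial>lebesgue)"
        using mA m by (intro mult_left_mono W f f0 A R) (auto simp: mass)
      also have "\<dots> = (\<integral>\<^sup>+x. ennreal (\<theta> powr lam) * (ennreal (f x * (R + norm (x - a)) powr lam) * indicator A x) \<partial>lebesgue)"
      proof (rule nn_integral_cmult[symmetric])
        have [measurable]: "(\<lambda>x. R + norm (x - a)) \<in> borel_measurable lebesgue"
          by (intro measurable_completion) measurable
        show "(\<lambda>x. ennreal (f x * (R + norm (x - a)) powr lam) * indicator A x) \<in> borel_measurable lebesgue"
          by measurable
      qed
      also have "\<dots> \<le> (\<integral>\<^sup>+x. ennreal (f x * norm (x - y) powr lam) \<partial>lebesgue)"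
      proof (rule nn_integral_mono)
        fix x
        show "ennreal (\<theta> powr lam) * (ennreal (f x * (R + norm (x - a)) powr lam) * indicator A x)
          \<le> ennreal (f x * norm (x - y) powr lam)"
        proof (cases "x \<in> A")
          case True
          have pos: "0 \<le> R + norm (x - a)" using R by simp
          have "(\<theta> * (R + norm (x - a))) powr lam \<le> norm (x - y) powr lam"
            using far[OF True] \<theta> pos d by (intro powr_mono2) auto
          then have "\<theta> powr lam * (f x * (R + norm (x - a)) powr lam) \<le> f x * norm (x - y) powr lam"
            using f0 \<theta> pos by (simp add: powr_mult mult.left_commute mult_left_mono)
          then show ?thesis using True f0 by (simp flip: ennreal_mult add: ennreal_leI)
        qed simp
      qed
      finally show ?thesis unfolding t_def .
    qed
    then show "\<exists>x0 R. 0 < R \<and> (\<forall>y.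
      ennreal (c * R powr - (real DIM('a) * (1 / p - 1)) * m powr (1 / p) * (R + norm (y - x0)) powr lam)
        \<le> (\<integral>\<^sup>+x. ennreal (f x * norm (x - y) powr lam) \<partial>lebesgue))"
      using R unfolding d_def by blast
  qed
qed

theorem theorem1:
  fixes p r lam :: real
  assumes "0 < p" "p < 1" "0 < r" "r < 1" "0 < lam"
    and "1 / p + 1 / r - lam / real CARD('n::finite) = 2"
  shows "\<exists>C::real. C > 0 \<and>
    (\<forall>f g :: real ^ 'n \<Rightarrow> real.
      f \<in> Lspace p \<longrightarrow> g \<in> Lspace r \<longrightarrow> (\<forall>x. 0 \<le> f x) \<longrightarrow> (\<forall>x. 0 \<le> g x) \<longrightarrow>
      (\<integral>\<^sup>+ y. (\<integral>\<^sup>+ x. ennreal (f x * norm (x - y) powr lam * g y) \<partial>lebesgue) \<partial>lebesgue)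
        \<ge> ennreal (C * Lnorm p f * Lnorm r g))"
proof -
  let ?n = "real DIM(real ^ 'n)"
  define d where "d = ?n * (1 / p - 1)"
  have n: "?n > 0" by simp
  have lam: "lam = d + ?n * (1 / r - 1)"
  proof -
    have "lam / ?n = 1 / p + 1 / r - 2" using assms(6) by simp
    then have "lam = ?n * (1 / p + 1 / r - 2)" using n by (simp add: divide_eq_eq mult.commute)
    then show ?thesis unfolding d_def by (simp add: algebra_simps)
  qed
  have "?n * (1 / p - 1) > 0" "?n * (1 / r - 1) > 0" using assms(1-4) n by auto
  then have lp: "?n * (1 / p - 1) < lam" and lr: "?n * (1 / r - 1) < lam"
    using lam unfolding d_def by linarith+
  obtain c1 where c1: "c1 > 0" and pot: "\<And>(f::real ^ 'n \<Rightarrow> real) m.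
    f \<in> borel_measurable lebesgue \<Longrightarrow> (\<forall>x. 0 \<le> f x) \<Longrightarrow> 0 < m \<Longrightarrow>
    (\<integral>\<^sup>+x. ennreal (f x powr p) \<partial>lebesgue) = ennreal m \<Longrightarrow>
    (\<exists>x0 R. 0 < R \<and> (\<forall>y.
      ennreal (c1 * R powr - d * m powr (1 / p) * (R + norm (y - x0)) powr lam)
        \<le> (\<integral>\<^sup>+x. ennreal (f x * norm (x - y) powr lam) \<partial>lebesgue)))"
    by (rule potential_ge[OF assms(1,2) lp, folded d_def]) blast
  obtain c2 where c2: "c2 > 0" and W: "\<And>(g::real ^ 'n \<Rightarrow> real) A \<rho> a m.
    g \<in> borel_measurable lebesgue \<Longrightarrow> (\<forall>x. 0 \<le> g x) \<Longrightarrow> A \<in> sets lebesgue \<Longrightarrow> 0 < \<rho> \<Longrightarrow> 0 < m \<Longrightarrow>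
    ennreal m \<le> (\<integral>\<^sup>+x\<in>A. ennreal (g x powr r) \<partial>lebesgue) \<Longrightarrow>
    ennreal (c2 * \<rho> powr (lam - ?n * (1 / r - 1)) * m powr (1 / r))
      \<le> (\<integral>\<^sup>+x\<in>A. ennreal (g x * (\<rho> + norm (x - a)) powr lam) \<partial>lebesgue)"
    by (rule weighted_integral_ge[OF assms(3,4) lr]) blast
  show ?thesis
  proof (intro exI[of _ "c1 * c2"] conjI allI impI)
    show "c1 * c2 > 0" using c1 c2 by simp
    fix f g :: "real ^ 'n \<Rightarrow> real"
    assume fL: "f \<in> Lspace p" and gL: "g \<in> Lspace r" and f0: "\<forall>x. 0 \<le> f x" and g0: "\<forall>x. 0 \<le> g x"
    have [measurable]: "f \<in> borel_measurable lebesgue" "g \<in> borel_measurable lebesgue"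
      using fL gL by (auto simp: Lspace_def)
    define m k where "m = enn2real (\<integral>\<^sup>+x. ennreal (f x powr p) \<partial>lebesgue)"
      and "k = enn2real (\<integral>\<^sup>+x. ennreal (g x powr r) \<partial>lebesgue)"
    have m: "(\<integral>\<^sup>+x. ennreal (f x powr p) \<partial>lebesgue) = ennreal m"
      and k: "(\<integral>\<^sup>+x. ennreal (g x powr r) \<partial>lebesgue) = ennreal k"
      using fL gL f0 g0 unfolding m_def k_def Lspace_def by (auto simp: ennreal_enn2real)
    have norms: "Lnorm p f = m powr (1 / p)" "Lnorm r g = k powr (1 / r)"
      using f0 g0 unfolding Lnorm_def m_def k_def by auto
    show "ennreal (c1 * c2 * Lnorm p f * Lnorm r g)
      \<le> (\<integral>\<^sup>+ y. (\<integral>\<^sup>+ x. ennreal (f x * norm (x - y) powr lam * g y) \<partial>lebesgue) \<partial>lebesgue)"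
    proof (cases "0 < m \<and> 0 < k")
      case False
      then have "m = 0 \<or> k = 0" unfolding m_def k_def by (auto simp: less_le)
      then show ?thesis unfolding norms by auto
    next
      case True
      obtain x0 R where R: "R > 0" and low: "\<And>y.
          ennreal (c1 * R powr - d * m powr (1 / p) * (R + norm (y - x0)) powr lam)
            \<le> (\<integral>\<^sup>+x. ennreal (f x * norm (x - y) powr lam) \<partial>lebesgue)"
        using pot[OF _ f0 _ m] True by auto
      define b where "b = c1 * R powr - d * m powr (1 / p)"
      have b: "b > 0" unfolding b_def using c1 R True by simp
      \<comment> \<open>The scale \<open>R\<close> disappears because \<open>lam - n * (1/r - 1) = d\<close>.\<close>
      have "R powr - d * R powr d = 1" using R by (simp add: powr_minus)
      then have "c1 * c2 * Lnorm p f * Lnorm r g = b * (c2 * R powr (lam - ?n * (1 / r - 1)) * k powr (1 / r))"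
        unfolding norms b_def lam by (simp add: mult_ac)
      then have "ennreal (c1 * c2 * Lnorm p f * Lnorm r g)
          = ennreal b * ennreal (c2 * R powr (lam - ?n * (1 / r - 1)) * k powr (1 / r))"
        using b by (metis ennreal_mult' less_imp_le)
      also have "\<dots> \<le> ennreal b * (\<integral>\<^sup>+y\<in>UNIV. ennreal (g y * (R + norm (y - x0)) powr lam) \<partial>lebesgue)"
        using True R g0 k by (intro mult_left_mono W) auto
      also have "\<dots> = (\<integral>\<^sup>+y. ennreal b * ennreal (g y * (R + norm (y - x0)) powr lam) \<partial>lebesgue)"
      proof -
        have [measurable]: "(\<lambda>y. R + norm (y - x0)) \<in> borel_measurable lebesgue"
          by (intro measurable_completion) measurable
        show ?thesis by (simp add: nn_integral_cmult)
      qed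
      also have "\<dots> \<le> (\<integral>\<^sup>+ y. (\<integral>\<^sup>+ x. ennreal (f x * norm (x - y) powr lam * g y) \<partial>lebesgue) \<partial>lebesgue)"
      proof (rule nn_integral_mono)
        fix y :: "real ^ 'n"
        have [measurable]: "(\<lambda>x. norm (x - y)) \<in> borel_measurable lebesgue"
          by (intro measurable_completion) measurable
        have "ennreal b * ennreal (g y * (R + norm (y - x0)) powr lam)
            = ennreal (b * (R + norm (y - x0)) powr lam) * ennreal (g y)"
          using b g0 by (simp add: mult_ac flip: ennreal_mult)
        also have "\<dots> \<le> (\<integral>\<^sup>+x. ennreal (f x * norm (x - y) powr lam) \<partial>lebesgue) * ennreal (g y)"
          unfolding b_def by (intro mult_right_mono low) auto
        also have "\<dots> = (\<integral>\<^sup>+x. ennreal (f x * norm (x - y) powr lam * g y) \<partial>lebesgue)"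
          using f0 g0 by (simp add: nn_integral_multc ennreal_mult)
        finally show "ennreal b * ennreal (g y * (R + norm (y - x0)) powr lam)
          \<le> (\<integral>\<^sup>+x. ennreal (f x * norm (x - y) powr lam * g y) \<partial>lebesgue)" .
      qed
      finally show ?thesis .
    qed
  qed
qed

end
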